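(* Let $n\ge1$ be an integer and $\mathbb{K}$ a field of characteristic zero. The algebra $M_n(\mathbb{K})$ of $n\times n$ matrices factorizes as $M_n(\mathbb{K})=D^n_{\mathbb{K}}\,C^n_{\mathbb{K}}$, where $D^n_{\mathbb{K}}$ is the subalgebra of diagonal matrices and $C^n_{\mathbb{K}}$ is the subalgebra of circulant matrices.
   Context: A circulant $n\times n$ matrix is a matrix $\operatorname{circ}(c_1,\dots,c_n)$ whose $(i,j)$ entry is $c_{j-i+1}$ (subscripts mod $n$). If $X$ is an associative unital algebra and $A,B$ are subalgebras of $X$, one says that $X$ factorizes as $X=AB$ if the map $A\otimes B\to X$, $a\otimes b\mapsto ab$, is a linear isomorphism. *)

theory Defs
  imports "Jordan_Normal_Form.VS_Connect" "HOL-Algebra.Subrings"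
begin

section \<open>Tensor products of vector spaces\<close>

text \<open>A vector space is represented by a \<^const>\<open>module\<close> record, as in \<^locale>\<open>vectorspace\<close>. That
  record type also has fields for a multiplication and a unit; they play no role for the spaces
  constructed in this section and are left unspecified.\<close>

definition free_vs :: "('k, 'r) ring_scheme \<Rightarrow> 'i set \<Rightarrow> ('k, 'i \<Rightarrow> 'k) module" where
  "free_vs K I = \<lparr>
     carrier = {f. (\<forall>i\<in>I. f i \<in> carrier K) \<and> (\<forall>i. i \<notin> I \<longrightarrow> f i = \<zero>\<^bsub>K\<^esub>) \<and> finite {i. f i \<noteq> \<zero>\<^bsub>K\<^esub>}},
     mult = undefined,
     one = undefined,
     zero = (\<lambda>i. \<zero>\<^bsub>K\<^esub>),
     add = (\<lambda>f g i. f i \<oplus>\<^bsub>K\<^esub> g i),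
     smult = (\<lambda>c f i. c \<otimes>\<^bsub>K\<^esub> f i)\<rparr>"

definition free_gen :: "('k, 'r) ring_scheme \<Rightarrow> 'i \<Rightarrow> 'i \<Rightarrow> 'k" where
  "free_gen K i = (\<lambda>j. if j = i then \<one>\<^bsub>K\<^esub> else \<zero>\<^bsub>K\<^esub>)"

text \<open>The quotient by a subspace \<open>N\<close>. For \<open>X = N + x\<close> every \<open>N + c x'\<close> with \<open>x' \<in> X\<close> is the same
  coset, so the union below is just \<open>N + c x\<close>.\<close>

definition quotient_vs ::
    "('k, 'v, 'm) module_scheme \<Rightarrow> 'v set \<Rightarrow> ('k, 'v set) module" where
  "quotient_vs V N = \<lparr>
     carrier = a_rcosets\<^bsub>V\<^esub> N,
     mult = undefined,
     one = undefined,
     zero = N,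
     add = (\<lambda>X Y. X <+>\<^bsub>V\<^esub> Y),
     smult = (\<lambda>c X. \<Union>x\<in>X. N +>\<^bsub>V\<^esub> (c \<odot>\<^bsub>V\<^esub> x))\<rparr>"

definition tensor_relators ::
    "('k, 'r) ring_scheme \<Rightarrow> ('k, 'v, 'm) module_scheme \<Rightarrow> ('k, 'w, 'n) module_scheme
      \<Rightarrow> ('v \<times> 'w \<Rightarrow> 'k) set" where
  "tensor_relators K V W = (let F = free_vs K (carrier V \<times> carrier W); e = free_gen K in
     {e (v \<oplus>\<^bsub>V\<^esub> v', w) \<ominus>\<^bsub>F\<^esub> (e (v, w) \<oplus>\<^bsub>F\<^esub> e (v', w)) |v v' w.
        v \<in> carrier V \<and> v' \<in> carrier V \<and> w \<in> carrier W} \<union>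
     {e (v, w \<oplus>\<^bsub>W\<^esub> w') \<ominus>\<^bsub>F\<^esub> (e (v, w) \<oplus>\<^bsub>F\<^esub> e (v, w')) |v w w'.
        v \<in> carrier V \<and> w \<in> carrier W \<and> w' \<in> carrier W} \<union>
     {e (c \<odot>\<^bsub>V\<^esub> v, w) \<ominus>\<^bsub>F\<^esub> (c \<odot>\<^bsub>F\<^esub> e (v, w)) |c v w.
        c \<in> carrier K \<and> v \<in> carrier V \<and> w \<in> carrier W} \<union>
     {e (v, c \<odot>\<^bsub>W\<^esub> w) \<ominus>\<^bsub>F\<^esub> (c \<odot>\<^bsub>F\<^esub> e (v, w)) |c v w.
        c \<in> carrier K \<and> v \<in> carrier V \<and> w \<in> carrier W})"

definition tensor_null ::
    "('k, 'r) ring_scheme \<Rightarrow> ('k, 'v, 'm) module_scheme \<Rightarrow> ('k, 'w, 'n) module_scheme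
      \<Rightarrow> ('v \<times> 'w \<Rightarrow> 'k) set" where
  "tensor_null K V W =
     LinearCombinations.module.span K (free_vs K (carrier V \<times> carrier W)) (tensor_relators K V W)"

definition tensor_vs ::
    "('k, 'r) ring_scheme \<Rightarrow> ('k, 'v, 'm) module_scheme \<Rightarrow> ('k, 'w, 'n) module_scheme
      \<Rightarrow> ('k, ('v \<times> 'w \<Rightarrow> 'k) set) module" where
  "tensor_vs K V W = quotient_vs (free_vs K (carrier V \<times> carrier W)) (tensor_null K V W)"

definition pure_tensor ::
    "('k, 'r) ring_scheme \<Rightarrow> ('k, 'v, 'm) module_scheme \<Rightarrow> ('k, 'w, 'n) module_scheme
      \<Rightarrow> 'v \<Rightarrow> 'w \<Rightarrow> ('v \<times> 'w \<Rightarrow> 'k) set" where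
  "pure_tensor K V W v w =
     tensor_null K V W +>\<^bsub>free_vs K (carrier V \<times> carrier W)\<^esub> free_gen K (v, w)"

section \<open>Factorizations of algebras\<close>

text \<open>HOL-Algebra's locale \<^locale>\<open>algebra\<close> only covers commutative algebras.\<close>

locale assoc_algebra = vectorspace K X + ring X for K and X +
  assumes smult_mult_left: "\<lbrakk>c \<in> carrier K; x \<in> carrier X; y \<in> carrier X\<rbrakk>
      \<Longrightarrow> (c \<odot>\<^bsub>X\<^esub> x) \<otimes>\<^bsub>X\<^esub> y = c \<odot>\<^bsub>X\<^esub> (x \<otimes>\<^bsub>X\<^esub> y)"
    and smult_mult_right: "\<lbrakk>c \<in> carrier K; x \<in> carrier X; y \<in> carrier X\<rbrakk>
      \<Longrightarrow> x \<otimes>\<^bsub>X\<^esub> (c \<odot>\<^bsub>X\<^esub> y) = c \<odot>\<^bsub>X\<^esub> (x \<otimes>\<^bsub>X\<^esub> y)"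

definition unital_subalgebra ::
    "('k, 'r) ring_scheme \<Rightarrow> 'x set \<Rightarrow> ('k, 'x, 'm) module_scheme \<Rightarrow> bool" where
  "unital_subalgebra K A X \<longleftrightarrow> VectorSpace.subspace K A X \<and> subring A X"

definition linear_iso ::
    "('k, 'r) ring_scheme \<Rightarrow> ('k, 'v, 'm) module_scheme \<Rightarrow> ('k, 'w, 'n) module_scheme
      \<Rightarrow> ('v \<Rightarrow> 'w) \<Rightarrow> bool" where
  "linear_iso K V W f \<longleftrightarrow> linear_map K V W f \<and> bij_betw f (carrier V) (carrier W)"

text \<open>Pure tensors span the tensor product, so there is at most one linear map sending each
  \<open>a \<otimes> b\<close> to \<open>a b\<close>: the existentially quantified \<open>\<mu>\<close> is the multiplication map.\<close>

definition factorizes ::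
    "('k, 'r) ring_scheme \<Rightarrow> ('k, 'x, 'm) module_scheme \<Rightarrow> 'x set \<Rightarrow> 'x set \<Rightarrow> bool" where
  "factorizes K X A B \<longleftrightarrow>
     assoc_algebra K X \<and> unital_subalgebra K A X \<and> unital_subalgebra K B X \<and>
     (let VA = X\<lparr>carrier := A\<rparr>; VB = X\<lparr>carrier := B\<rparr> in
       \<exists>\<mu>. linear_iso K (tensor_vs K VA VB) X \<mu> \<and>
           (\<forall>a\<in>A. \<forall>b\<in>B. \<mu> (pure_tensor K VA VB a b) = a \<otimes>\<^bsub>X\<^esub> b))"

section \<open>Diagonal and circulant matrices\<close>

text \<open>With \<open>nr = nc = n\<close>, the record \<^const>\<open>module_mat\<close> carries the matrix product and the identity
  matrix, hence the whole algebra structure.\<close>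

abbreviation mat_algebra :: "'a :: field itself \<Rightarrow> nat \<Rightarrow> ('a, 'a mat) module" where
  "mat_algebra ty n \<equiv> module_mat ty n n"

definition diagonal_mats :: "nat \<Rightarrow> 'a :: field mat set" where
  "diagonal_mats n = {A \<in> carrier_mat n n. diagonal_mat A}"

text \<open>Indices start at 0: the entry \<open>c $ k\<close> is \<open>c\<^sub>k\<^sub>+\<^sub>1\<close>, so that the \<open>(i,j)\<close> entry
  \<open>c\<^sub>j\<^sub>-\<^sub>i\<^sub>+\<^sub>1\<close> becomes \<open>c $ ((j - i) mod n)\<close>; adding \<open>n\<close> avoids truncated subtraction.\<close>

definition circ :: "'a vec \<Rightarrow> 'a mat" where
  "circ c = (let n = dim_vec c in mat n n (\<lambda>(i, j). c $ ((j + n - i) mod n)))"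

definition circulant_mats :: "nat \<Rightarrow> 'a :: field mat set" where
  "circulant_mats n = circ ` carrier_vec n"

end

theory Submission
  imports Defs
begin

text \<open>
  The product of a diagonal matrix \<open>D\<close> and a circulant matrix \<open>C\<close> has \<open>i\<close>-th row \<open>D\<^sub>i\<^sub>i\<close> times the
  \<open>i\<close>-th row of \<open>C\<close>, and a circulant matrix is determined by any one of its rows, which can be
  prescribed freely. Hence a matrix \<open>A\<close> is recovered from the circulant matrices
  \<open>\<phi>\<^sub>i A\<close> that share their \<open>i\<close>-th row with \<open>A\<close>: writing \<open>E\<^sub>i\<close> for the
  diagonal idempotent at position \<open>i\<close>, one has \<open>A = \<Sum>\<^sub>i E\<^sub>i \<phi>\<^sub>i A\<close>
  (\<open>row_circulant_expansion\<close>) and \<open>\<phi>\<^sub>i (D C) = D\<^sub>i\<^sub>i C\<close>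
  (\<open>row_circulant_diagonal_mult\<close>).

  These two identities say that \<open>A \<mapsto> \<Sum>\<^sub>i E\<^sub>i \<otimes> \<phi>\<^sub>i A\<close> is a two-sided inverse of the
  multiplication map \<open>\<mu>\<close>. The first gives \<open>\<mu> (\<Sum>\<^sub>i E\<^sub>i \<otimes> \<phi>\<^sub>i A) = A\<close>. By the second, the
  other composition sends \<open>D \<otimes> C\<close> to
  \<open>\<Sum>\<^sub>i E\<^sub>i \<otimes> D\<^sub>i\<^sub>i C = (\<Sum>\<^sub>i D\<^sub>i\<^sub>i E\<^sub>i) \<otimes> C = D \<otimes> C\<close>,
  so it is the identity because pure tensors span. Exhibiting an inverse avoids bases and dimension
  counts of tensor products; the lemma \<open>tensor_map_bij\<close> is this argument for arbitrary modules.

  The multiplication map itself comes from the universal property of the tensor product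
  (\<open>tensor_lift\<close>), obtained by composing those of the free module and of the quotient. That pure tensors
  span is used in the form that linear maps agreeing on them are equal (\<open>tensor_hom_eqI\<close>).
\<close>

hide_const (open) Modules.module Modules.module_hom

section \<open>Linear maps and images of modules\<close>

lemma module_homI:
  assumes "\<And>x. x \<in> carrier M \<Longrightarrow> f x \<in> carrier N"
    and "\<And>x y. \<lbrakk>x \<in> carrier M; y \<in> carrier M\<rbrakk> \<Longrightarrow> f (x \<oplus>\<^bsub>M\<^esub> y) = f x \<oplus>\<^bsub>N\<^esub> f y"
    and "\<And>c x. \<lbrakk>c \<in> carrier R; x \<in> carrier M\<rbrakk> \<Longrightarrow> f (c \<odot>\<^bsub>M\<^esub> x) = c \<odot>\<^bsub>N\<^esub> f x"
  shows "f \<in> module_hom R M N"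
  using assms by (simp add: LinearCombinations.module_hom_def)

lemma module_hom_comp:
  assumes "f \<in> module_hom R M N" "g \<in> module_hom R N P"
  shows "(\<lambda>x. g (f x)) \<in> module_hom R M P"
  using assms by (auto simp: LinearCombinations.module_hom_def Pi_iff)

lemma module_hom_finsum:
  assumes M: "Module.module R M" and N: "Module.module R N" and f: "f \<in> module_hom R M N"
    and "finite I" "\<And>i. i \<in> I \<Longrightarrow> g i \<in> carrier M"
  shows "f (\<Oplus>\<^bsub>M\<^esub>i\<in>I. g i) = (\<Oplus>\<^bsub>N\<^esub>i\<in>I. f (g i))"
proof -
  interpret M: Module.module R M by (rule M)
  interpret N: Module.module R N by (rule N)
  interpret f: mod_hom R M N f by unfold_locales (rule f)
  show ?thesis
    using assms(4,5) by (induction I rule: finite_induct) (auto simp: Pi_iff)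
qed

text \<open>Every module axiom is an equation or an existence statement that survives a surjective map preserving
  the operations. Applied to the coset map, this makes quotients modules.\<close>

lemma module_image:
  fixes Q :: "('a, 'q, 'm) module_scheme"
  assumes "Module.module R M" and onto: "q ` carrier M = carrier Q" and hom: "q \<in> module_hom R M Q"
    and zero: "q \<zero>\<^bsub>M\<^esub> = \<zero>\<^bsub>Q\<^esub>"
  shows "Module.module R Q"
proof -
  interpret Module.module R M by fact
  have add: "q x \<oplus>\<^bsub>Q\<^esub> q y = q (x \<oplus>\<^bsub>M\<^esub> y)" if "x \<in> carrier M" "y \<in> carrier M" for x y
    using LinearCombinations.module_hom_add[OF hom that] by simp
  have smult: "c \<odot>\<^bsub>Q\<^esub> q x = q (c \<odot>\<^bsub>M\<^esub> x)" if "c \<in> carrier R" "x \<in> carrier M" for c x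
    using LinearCombinations.module_hom_smult[OF hom that] by simp
  have ex_neg: "\<exists>z\<in>carrier M. q (x \<oplus>\<^bsub>M\<^esub> z) = q \<zero>\<^bsub>M\<^esub>" if "x \<in> carrier M" for x
    using that by (intro bexI[of _ "\<ominus>\<^bsub>M\<^esub> x"]) (auto simp: r_neg)
  show ?thesis
  proof (rule module_criteria, unfold onto[symmetric])
  qed (auto simp: add smult zero[symmetric] R.is_cring ex_neg a_ac smult_l_distr smult_r_distr smult_assoc1)
qed

section \<open>Free vector spaces\<close>

lemma (in cring) free_vs_carrierD: "f \<in> carrier (free_vs R I) \<Longrightarrow> f i \<in> carrier R"
  by (cases "i \<in> I") (auto simp: free_vs_def)

lemma free_vs_ops:
  "f \<oplus>\<^bsub>free_vs K I\<^esub> g = (\<lambda>i. f i \<oplus>\<^bsub>K\<^esub> g i)"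
  "c \<odot>\<^bsub>free_vs K I\<^esub> f = (\<lambda>i. c \<otimes>\<^bsub>K\<^esub> f i)"
  "\<zero>\<^bsub>free_vs K I\<^esub> = (\<lambda>i. \<zero>\<^bsub>K\<^esub>)"
  by (simp_all add: free_vs_def)

lemma (in cring) free_vs_module:
  fixes I :: "'i set"
  shows "Module.module R (free_vs R I)"
proof (rule module_criteria)
  have fin: "finite {i. h i \<noteq> \<zero>}" if "finite {i. f i \<noteq> \<zero>}" "finite {i. g i \<noteq> \<zero>}"
    "\<And>i. \<lbrakk>f i = \<zero>; g i = \<zero>\<rbrakk> \<Longrightarrow> h i = \<zero>" for f g h :: "'i \<Rightarrow> 'a"
    using that(3) by (intro finite_subset[OF _ finite_UnI[OF that(1,2)]]) auto
  have cl: "f i \<in> carrier R" if "f \<in> carrier (free_vs R I)" for f i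
    using that by (cases "i \<in> I") (auto simp: free_vs_def)
  show "\<forall>v w. v \<in> carrier (free_vs R I) \<and> w \<in> carrier (free_vs R I) \<longrightarrow>
      v \<oplus>\<^bsub>free_vs R I\<^esub> w \<in> carrier (free_vs R I)"
  proof (intro allI impI)
    fix v w assume "v \<in> carrier (free_vs R I) \<and> w \<in> carrier (free_vs R I)"
    then show "v \<oplus>\<^bsub>free_vs R I\<^esub> w \<in> carrier (free_vs R I)"
      by (auto simp: free_vs_def intro: fin[of v w])
  qed
  show "\<forall>v\<in>carrier (free_vs R I). \<exists>w\<in>carrier (free_vs R I). v \<oplus>\<^bsub>free_vs R I\<^esub> w = \<zero>\<^bsub>free_vs R I\<^esub>"
  proof
    fix v assume v: "v \<in> carrier (free_vs R I)"
    then have "(\<lambda>i. \<ominus> v i) \<in> carrier (free_vs R I)"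
      by (auto simp: free_vs_def intro: fin[of v v])
    with v cl[OF v] show "\<exists>w\<in>carrier (free_vs R I). v \<oplus>\<^bsub>free_vs R I\<^esub> w = \<zero>\<^bsub>free_vs R I\<^esub>"
      by (intro bexI[of _ "\<lambda>i. \<ominus> v i"]) (auto simp: free_vs_def r_neg)
  qed
  show "\<forall>c v. c \<in> carrier R \<and> v \<in> carrier (free_vs R I) \<longrightarrow>
      c \<odot>\<^bsub>free_vs R I\<^esub> v \<in> carrier (free_vs R I)"
  proof (intro allI impI)
    fix c v assume "c \<in> carrier R \<and> v \<in> carrier (free_vs R I)"
    then show "c \<odot>\<^bsub>free_vs R I\<^esub> v \<in> carrier (free_vs R I)"
      by (auto simp: free_vs_def intro: fin[of v v])
  qed
  show "\<zero>\<^bsub>free_vs R I\<^esub> \<in> carrier (free_vs R I)"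
    by (simp add: free_vs_def)
qed (auto simp: is_cring free_vs_carrierD free_vs_ops a_ac m_ac l_distr r_distr)

lemma (in cring) free_gen_closed: "i \<in> I \<Longrightarrow> free_gen R i \<in> carrier (free_vs R I)"
  by (auto simp: free_vs_def free_gen_def)

text \<open>Induction on the size of the support: split off one multiple of a generator at a time.\<close>

lemma (in cring) free_vs_hom_eqI:
  assumes "Module.module R M" and f: "f \<in> module_hom R (free_vs R I) M" and g: "g \<in> module_hom R (free_vs R I) M"
    and gen: "\<And>i. i \<in> I \<Longrightarrow> f (free_gen R i) = g (free_gen R i)"
    and x: "x \<in> carrier (free_vs R I)"
  shows "f x = g x"
proof -
  interpret M: Module.module R M by fact
  interpret F: Module.module R "free_vs R I" by (rule free_vs_module)
  interpret f: mod_hom R "free_vs R I" M f by unfold_locales (rule f)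
  interpret g: mod_hom R "free_vs R I" M g by unfold_locales (rule g)
  have "\<forall>x\<in>carrier (free_vs R I). {i. x i \<noteq> \<zero>} = S \<longrightarrow> f x = g x" if "finite S" for S
    using that
  proof (induction S rule: finite_induct)
    case empty
    have "x = \<zero>\<^bsub>free_vs R I\<^esub>" if "{i. x i \<noteq> \<zero>} = {}" for x
      using that by (auto simp: free_vs_ops)
    then show ?case by (metis f.f0_is_0 g.f0_is_0)
  next
    case (insert i S)
    show ?case
    proof (intro ballI impI)
      fix x assume x: "x \<in> carrier (free_vs R I)" and S: "{j. x j \<noteq> \<zero>} = insert i S"
      define y where "y = x(i := \<zero>)"
      have yS: "{j. y j \<noteq> \<zero>} = S"
        using S insert.hyps by (auto simp: y_def)
      then have "finite {j. y j \<noteq> \<zero>}" using insert.hyps by simp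
      then have i: "i \<in> I" and xi: "x i \<in> carrier R" and y: "y \<in> carrier (free_vs R I)"
        using x S free_vs_carrierD[OF x] by (auto simp: free_vs_def) (auto simp: y_def)
      note e = free_gen_closed[OF i]
      have "f y = g y"
        using insert.IH y yS by blast
      moreover have "x = (x i \<odot>\<^bsub>free_vs R I\<^esub> free_gen R i) \<oplus>\<^bsub>free_vs R I\<^esub> y"
        using free_vs_carrierD[OF x] by (auto simp: y_def free_vs_ops free_gen_def)
      ultimately show "f x = g x"
        using xi y e gen[OF i] by (metis F.smult_closed f.f_add f.f_smult g.f_add g.f_smult)
    qed
  qed
  moreover have "finite {i. x i \<noteq> \<zero>}"
    using x by (simp add: free_vs_def)
  ultimately show ?thesis
    using x by blast
qed

text \<open>The linear extension of \<open>\<beta>\<close>. The support is finite for elements of the free module, and summing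
  over it keeps the definition independent of the index set.\<close>

definition free_lift ::
    "('k, 'r) ring_scheme \<Rightarrow> ('k, 'v, 'm) module_scheme \<Rightarrow> ('i \<Rightarrow> 'v) \<Rightarrow> ('i \<Rightarrow> 'k) \<Rightarrow> 'v" where
  "free_lift K M \<beta> f = (\<Oplus>\<^bsub>M\<^esub>i\<in>{i. f i \<noteq> \<zero>\<^bsub>K\<^esub>}. f i \<odot>\<^bsub>M\<^esub> \<beta> i)"

lemma (in Module.module) free_lift_hom:
  assumes "\<And>i. i \<in> I \<Longrightarrow> \<beta> i \<in> carrier M"
  shows "free_lift R M \<beta> \<in> module_hom R (free_vs R I) M"
proof (rule module_homI)
  have term_closed: "f i \<odot>\<^bsub>M\<^esub> \<beta> i \<in> carrier M" if f: "f \<in> carrier (free_vs R I)" and i: "f i \<noteq> \<zero> \<or> i \<in> I" for f i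
  proof -
    have "i \<in> I" using f i by (auto simp: free_vs_def)
    then show ?thesis using assms f by (auto simp: free_vs_def)
  qed
  \<comment> \<open>The supports of \<open>f\<close>, \<open>g\<close> and their sum differ; all the sums are moved to a common index set.\<close>
  have lift_eq: "free_lift R M \<beta> f = (\<Oplus>\<^bsub>M\<^esub>i\<in>S. f i \<odot>\<^bsub>M\<^esub> \<beta> i)"
    if f: "f \<in> carrier (free_vs R I)" and S: "finite S" "{i. f i \<noteq> \<zero>} \<subseteq> S" "S \<subseteq> I" for f S
    unfolding free_lift_def
    by (rule add.finprod_mono_neutral_cong_left) (use f S assms term_closed[OF f] in auto)
  show closed: "free_lift R M \<beta> f \<in> carrier M" if "f \<in> carrier (free_vs R I)" for f
    unfolding free_lift_def by (rule finsum_closed) (use term_closed[OF that] in auto)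
  {
    fix f g assume f: "f \<in> carrier (free_vs R I)" and g: "g \<in> carrier (free_vs R I)"
    let ?S = "{i. f i \<noteq> \<zero>} \<union> {i. g i \<noteq> \<zero>}"
    interpret F: Module.module R "free_vs R I" by (rule R.free_vs_module)
    have S: "finite ?S" "?S \<subseteq> I" using f g by (auto simp: free_vs_def)
    have fg: "{i. (f \<oplus>\<^bsub>free_vs R I\<^esub> g) i \<noteq> \<zero>} \<subseteq> ?S"
      by (auto simp: free_vs_ops)
    have "free_lift R M \<beta> (f \<oplus>\<^bsub>free_vs R I\<^esub> g) = (\<Oplus>\<^bsub>M\<^esub>i\<in>?S. (f \<oplus>\<^bsub>free_vs R I\<^esub> g) i \<odot>\<^bsub>M\<^esub> \<beta> i)"
      by (rule lift_eq[OF F.a_closed[OF f g] S(1) fg S(2)])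
    also have "\<dots> = (\<Oplus>\<^bsub>M\<^esub>i\<in>?S. f i \<odot>\<^bsub>M\<^esub> \<beta> i \<oplus>\<^bsub>M\<^esub> g i \<odot>\<^bsub>M\<^esub> \<beta> i)"
      by (rule finsum_cong')
        (use S assms R.free_vs_carrierD[OF f] R.free_vs_carrierD[OF g] in \<open>auto simp: free_vs_ops smult_l_distr subset_iff\<close>)
    also have "\<dots> = free_lift R M \<beta> f \<oplus>\<^bsub>M\<^esub> free_lift R M \<beta> g"
      using S f g term_closed by (subst (1 2) lift_eq[of _ ?S]) (auto intro!: finsum_addf)
    finally show "free_lift R M \<beta> (f \<oplus>\<^bsub>free_vs R I\<^esub> g) = free_lift R M \<beta> f \<oplus>\<^bsub>M\<^esub> free_lift R M \<beta> g" .
  next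
    fix c f assume c: "c \<in> carrier R" and f: "f \<in> carrier (free_vs R I)"
    interpret F: Module.module R "free_vs R I" by (rule R.free_vs_module)
    let ?S = "{i. f i \<noteq> \<zero>}"
    have S: "finite ?S" "?S \<subseteq> I" using f by (auto simp: free_vs_def)
    have cf: "{i. (c \<odot>\<^bsub>free_vs R I\<^esub> f) i \<noteq> \<zero>} \<subseteq> ?S"
      using c by (auto simp: free_vs_ops)
    have "free_lift R M \<beta> (c \<odot>\<^bsub>free_vs R I\<^esub> f) = (\<Oplus>\<^bsub>M\<^esub>i\<in>?S. (c \<odot>\<^bsub>free_vs R I\<^esub> f) i \<odot>\<^bsub>M\<^esub> \<beta> i)"
      by (rule lift_eq[OF F.smult_closed[OF c f] S(1) cf S(2)])
    also have "\<dots> = (\<Oplus>\<^bsub>M\<^esub>i\<in>?S. c \<odot>\<^bsub>M\<^esub> (f i \<odot>\<^bsub>M\<^esub> \<beta> i))"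
      by (rule finsum_cong')
        (use S assms c R.free_vs_carrierD[OF f] in \<open>auto simp: free_vs_ops smult_assoc1 subset_iff\<close>)
    also have "\<dots> = c \<odot>\<^bsub>M\<^esub> free_lift R M \<beta> f"
      unfolding free_lift_def by (rule finsum_smult[symmetric]) (use c f term_closed in auto)
    finally show "free_lift R M \<beta> (c \<odot>\<^bsub>free_vs R I\<^esub> f) = c \<odot>\<^bsub>M\<^esub> free_lift R M \<beta> f" .
  }
qed

lemma (in Module.module) free_lift_gen:
  assumes "\<beta> i \<in> carrier M"
  shows "free_lift R M \<beta> (free_gen R i) = \<beta> i"
proof -
  \<comment> \<open>In the zero ring the generators have empty support.\<close>
  have degenerate: "\<beta> i = \<zero>\<^bsub>M\<^esub>" if "\<one> = \<zero>"
    using that smult_one[OF assms] smult_l_null[OF assms] by metis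
  have "free_lift R M \<beta> (free_gen R i) = (\<Oplus>\<^bsub>M\<^esub>j\<in>{i}. free_gen R i j \<odot>\<^bsub>M\<^esub> \<beta> j)"
    unfolding free_lift_def
    by (rule add.finprod_mono_neutral_cong_left)
      (use assms degenerate in \<open>auto simp: free_gen_def\<close>)
  then show ?thesis using assms by (simp add: free_gen_def)
qed

section \<open>Quotients\<close>

lemma (in Module.module) submodule_abelian_subgroup:
  assumes "submodule R N M" shows "abelian_subgroup N M"
proof -
  interpret N: submodule R N M by fact
  have "N \<noteq> {}" using N.zero_closed by blast
  have "subgroup N (add_monoid M)"
    by (rule add.subgroupI)
      (use \<open>N \<noteq> {}\<close> N.subset N.m_closed N.smult_closed[of "\<ominus>\<^bsub>R\<^esub> \<one>\<^bsub>R\<^esub>"] in \<open>auto simp: smult_minus_1 subset_iff\<close>)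
  then show ?thesis
    by (intro abelian_subgroupI3 additive_subgroup.intro M.abelian_group_axioms)
qed

lemma (in Module.module) coset_eq_iff:
  assumes "submodule R N M" "x \<in> carrier M" "y \<in> carrier M"
  shows "N +>\<^bsub>M\<^esub> x = N +>\<^bsub>M\<^esub> y \<longleftrightarrow> x \<ominus>\<^bsub>M\<^esub> y \<in> N"
proof -
  interpret S: abelian_subgroup N M using assms(1) by (rule submodule_abelian_subgroup)
  show ?thesis
    unfolding a_minus_def S.a_rcos_module[OF assms(3,2), symmetric]
    using S.a_repr_independence'[OF _ assms(3)] S.a_repr_independenceD[OF assms(2)] by metis
qed

text \<open>Additivity is the arithmetic of cosets; for scalars the union in the quotient's scalar multiplication
  has to be seen to run over a single coset.\<close>

lemma (in Module.module) coset_hom: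
  assumes N: "submodule R N M"
  shows "(\<lambda>x. N +>\<^bsub>M\<^esub> x) \<in> module_hom R M (quotient_vs M N)"
proof -
  interpret S: abelian_subgroup N M using N by (rule submodule_abelian_subgroup)
  interpret N: submodule R N M by (rule N)
  show ?thesis
  proof (rule module_homI)
    fix c x assume c: "c \<in> carrier R" and x: "x \<in> carrier M"
    have eq: "\<forall>y\<in>N +>\<^bsub>M\<^esub> x. N +>\<^bsub>M\<^esub> (c \<odot>\<^bsub>M\<^esub> y) = N +>\<^bsub>M\<^esub> (c \<odot>\<^bsub>M\<^esub> x)"
    proof
      fix y assume y: "y \<in> N +>\<^bsub>M\<^esub> x"
      have yM: "y \<in> carrier M" using S.a_elemrcos_carrier[OF x y] .
      have "y \<ominus>\<^bsub>M\<^esub> x \<in> N" using S.a_rcos_module_imp[OF x y] by (simp add: a_minus_def)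
      then have "c \<odot>\<^bsub>M\<^esub> (y \<ominus>\<^bsub>M\<^esub> x) \<in> N" using c by simp
      also have "c \<odot>\<^bsub>M\<^esub> (y \<ominus>\<^bsub>M\<^esub> x) = c \<odot>\<^bsub>M\<^esub> y \<ominus>\<^bsub>M\<^esub> c \<odot>\<^bsub>M\<^esub> x"
        using c x yM by (simp add: a_minus_def smult_r_distr smult_r_minus)
      finally show "N +>\<^bsub>M\<^esub> (c \<odot>\<^bsub>M\<^esub> y) = N +>\<^bsub>M\<^esub> (c \<odot>\<^bsub>M\<^esub> x)"
        using c x yM by (simp add: coset_eq_iff[OF N])
    qed
    have "(\<Union>y\<in>N +>\<^bsub>M\<^esub> x. N +>\<^bsub>M\<^esub> (c \<odot>\<^bsub>M\<^esub> y)) = N +>\<^bsub>M\<^esub> (c \<odot>\<^bsub>M\<^esub> x)"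
      by (rule UN_constant_eq[OF S.a_rcos_self[OF x] eq])
    then show "N +>\<^bsub>M\<^esub> (c \<odot>\<^bsub>M\<^esub> x) = c \<odot>\<^bsub>quotient_vs M N\<^esub> (N +>\<^bsub>M\<^esub> x)"
      unfolding quotient_vs_def module.simps by (rule sym)
  next
    fix x y assume "x \<in> carrier M" "y \<in> carrier M"
    then show "N +>\<^bsub>M\<^esub> (x \<oplus>\<^bsub>M\<^esub> y) = (N +>\<^bsub>M\<^esub> x) \<oplus>\<^bsub>quotient_vs M N\<^esub> (N +>\<^bsub>M\<^esub> y)"
      unfolding quotient_vs_def ring.simps by (rule S.a_rcos_sum[symmetric])
  next
    fix x assume "x \<in> carrier M"
    then show "N +>\<^bsub>M\<^esub> x \<in> carrier (quotient_vs M N)"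
      unfolding quotient_vs_def partial_object.simps by (rule a_rcosetsI[OF N.subset])
  qed
qed

lemma (in Module.module) coset_onto: "(\<lambda>x. N +>\<^bsub>M\<^esub> x) ` carrier M = carrier (quotient_vs M N)"
  by (auto simp: quotient_vs_def A_RCOSETS_def')

lemma (in Module.module) quotient_vs_module:
  assumes N: "submodule R N M"
  shows "Module.module R (quotient_vs M N)"
proof (rule module_image[OF _ coset_onto coset_hom[OF N]])
  interpret S: abelian_subgroup N M using N by (rule submodule_abelian_subgroup)
  show "N +>\<^bsub>M\<^esub> \<zero>\<^bsub>M\<^esub> = \<zero>\<^bsub>quotient_vs M N\<^esub>"
    by (simp add: quotient_vs_def a_coset_add_zero S.a_subset)
qed (rule module_axioms)

text \<open>The universal property of the quotient: \<open>f\<close> can be evaluated on any representative of a coset.\<close>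

lemma (in Module.module) quotient_vs_lift:
  assumes N: "submodule R N M" and P: "Module.module R P" and f: "f \<in> module_hom R M P"
    and ker: "\<And>x. x \<in> N \<Longrightarrow> f x = \<zero>\<^bsub>P\<^esub>"
  obtains g where "g \<in> module_hom R (quotient_vs M N) P"
    and "\<And>x. x \<in> carrier M \<Longrightarrow> g (N +>\<^bsub>M\<^esub> x) = f x"
proof -
  interpret P: Module.module R P by (rule P)
  interpret f: mod_hom R M P f by unfold_locales (rule f)
  define g where "g X = f (SOME x. x \<in> carrier M \<and> X = N +>\<^bsub>M\<^esub> x)" for X
  have g: "g (N +>\<^bsub>M\<^esub> x) = f x" if x: "x \<in> carrier M" for x
  proof -
    define y where "y = (SOME y. y \<in> carrier M \<and> N +>\<^bsub>M\<^esub> x = N +>\<^bsub>M\<^esub> y)"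
    have y: "y \<in> carrier M \<and> N +>\<^bsub>M\<^esub> x = N +>\<^bsub>M\<^esub> y"
      unfolding y_def by (rule someI[of _ x]) (use x in auto)
    then have "x \<ominus>\<^bsub>M\<^esub> y \<in> N" using coset_eq_iff[OF N x] by blast
    then have "f x \<ominus>\<^bsub>P\<^esub> f y = \<zero>\<^bsub>P\<^esub>"
      using ker[of "x \<ominus>\<^bsub>M\<^esub> y"] x y by simp
    then show ?thesis
      unfolding g_def y_def[symmetric] using x y by simp
  qed
  have "g \<in> module_hom R (quotient_vs M N) P"
  proof (rule module_homI)
    have onto: "\<exists>x\<in>carrier M. X = N +>\<^bsub>M\<^esub> x" if "X \<in> carrier (quotient_vs M N)" for X
      using that coset_onto[of N] by blast
    fix X assume "X \<in> carrier (quotient_vs M N)"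
    then obtain x where x: "x \<in> carrier M" "X = N +>\<^bsub>M\<^esub> x" using onto by blast
    then show "g X \<in> carrier P" by (simp add: g)
    {
      fix Y assume "Y \<in> carrier (quotient_vs M N)"
      then obtain y where y: "y \<in> carrier M" "Y = N +>\<^bsub>M\<^esub> y" using onto by blast
      have "X \<oplus>\<^bsub>quotient_vs M N\<^esub> Y = N +>\<^bsub>M\<^esub> (x \<oplus>\<^bsub>M\<^esub> y)"
        unfolding x(2) y(2) by (rule LinearCombinations.module_hom_add[OF coset_hom[OF N] x(1) y(1), symmetric])
      then show "g (X \<oplus>\<^bsub>quotient_vs M N\<^esub> Y) = g X \<oplus>\<^bsub>P\<^esub> g Y"
        using x y by (simp add: g)
    next
      fix c assume c: "c \<in> carrier R"
      have "c \<odot>\<^bsub>quotient_vs M N\<^esub> X = N +>\<^bsub>M\<^esub> (c \<odot>\<^bsub>M\<^esub> x)"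
        unfolding x(2) by (rule LinearCombinations.module_hom_smult[OF coset_hom[OF N] c x(1), symmetric])
      then show "g (c \<odot>\<^bsub>quotient_vs M N\<^esub> X) = c \<odot>\<^bsub>P\<^esub> g X"
        using x c by (simp add: g)
    }
  qed
  with g show ?thesis by (rule that[rotated])
qed

section \<open>The tensor product\<close>

locale tensor_factors = V: Module.module K V + W: Module.module K W
  for K :: "('k, 'r) ring_scheme" and V :: "('k, 'v, 'm) module_scheme" and W :: "('k, 'w, 'n) module_scheme"
begin

abbreviation F where "F \<equiv> free_vs K (carrier V \<times> carrier W)"
abbreviation T where "T \<equiv> tensor_vs K V W"
abbreviation N where "N \<equiv> tensor_null K V W"
abbreviation pure (infixl "\<otimes>\<^sub>T" 70) where "v \<otimes>\<^sub>T w \<equiv> pure_tensor K V W v w"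

sublocale F: Module.module K F by (rule V.R.free_vs_module)

lemma free_gen_pair: "\<lbrakk>v \<in> carrier V; w \<in> carrier W\<rbrakk> \<Longrightarrow> free_gen K (v, w) \<in> carrier F"
  by (simp add: V.R.free_gen_closed)

lemma tensor_relators_closed: "tensor_relators K V W \<subseteq> carrier F"
  unfolding tensor_relators_def Let_def
  by (intro Un_least; clarify; intro F.minus_closed F.a_closed F.smult_closed free_gen_pair V.a_closed W.a_closed
      V.smult_closed W.smult_closed)

lemma tensor_null_submodule: "submodule K N F"
  unfolding tensor_null_def by (rule F.span_is_submodule[OF tensor_relators_closed])

lemma relator_null: "x \<in> tensor_relators K V W \<Longrightarrow> x \<in> N"
  unfolding tensor_null_def using F.in_own_span[OF tensor_relators_closed] by blast

sublocale T: Module.module K T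
  unfolding tensor_vs_def by (rule F.quotient_vs_module[OF tensor_null_submodule])

lemma coset_tensor_hom: "(\<lambda>x. N +>\<^bsub>F\<^esub> x) \<in> module_hom K F T"
  unfolding tensor_vs_def by (rule F.coset_hom[OF tensor_null_submodule])

lemma relator_coset_eq:
  assumes "x \<ominus>\<^bsub>F\<^esub> y \<in> tensor_relators K V W" "x \<in> carrier F" "y \<in> carrier F"
  shows "N +>\<^bsub>F\<^esub> x = N +>\<^bsub>F\<^esub> y"
  using F.coset_eq_iff[OF tensor_null_submodule assms(2,3)] relator_null[OF assms(1)] by simp

lemma pure_tensor_closed [simp, intro]:
  "\<lbrakk>v \<in> carrier V; w \<in> carrier W\<rbrakk> \<Longrightarrow> v \<otimes>\<^sub>T w \<in> carrier T"
  unfolding pure_tensor_def using LinearCombinations.module_hom_closed[OF coset_tensor_hom] free_gen_pair by blast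

lemma pure_tensor_add_left:
  assumes "v \<in> carrier V" "v' \<in> carrier V" "w \<in> carrier W"
  shows "(v \<oplus>\<^bsub>V\<^esub> v') \<otimes>\<^sub>T w = v \<otimes>\<^sub>T w \<oplus>\<^bsub>T\<^esub> v' \<otimes>\<^sub>T w"
proof -
  have "N +>\<^bsub>F\<^esub> free_gen K (v \<oplus>\<^bsub>V\<^esub> v', w) = N +>\<^bsub>F\<^esub> (free_gen K (v, w) \<oplus>\<^bsub>F\<^esub> free_gen K (v', w))"
  proof (rule relator_coset_eq)
  qed (use assms in \<open>unfold tensor_relators_def Let_def, blast\<close>, simp_all add: assms free_gen_pair)
  also have "\<dots> = v \<otimes>\<^sub>T w \<oplus>\<^bsub>T\<^esub> v' \<otimes>\<^sub>T w"
    unfolding pure_tensor_def using assms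
    by (intro LinearCombinations.module_hom_add[OF coset_tensor_hom] free_gen_pair)
  finally show ?thesis by (simp add: pure_tensor_def)
qed

lemma pure_tensor_add_right:
  assumes "v \<in> carrier V" "w \<in> carrier W" "w' \<in> carrier W"
  shows "v \<otimes>\<^sub>T (w \<oplus>\<^bsub>W\<^esub> w') = v \<otimes>\<^sub>T w \<oplus>\<^bsub>T\<^esub> v \<otimes>\<^sub>T w'"
proof -
  have "N +>\<^bsub>F\<^esub> free_gen K (v, w \<oplus>\<^bsub>W\<^esub> w') = N +>\<^bsub>F\<^esub> (free_gen K (v, w) \<oplus>\<^bsub>F\<^esub> free_gen K (v, w'))"
  proof (rule relator_coset_eq)
  qed (use assms in \<open>unfold tensor_relators_def Let_def, blast\<close>, simp_all add: assms free_gen_pair)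
  also have "\<dots> = v \<otimes>\<^sub>T w \<oplus>\<^bsub>T\<^esub> v \<otimes>\<^sub>T w'"
    unfolding pure_tensor_def using assms
    by (intro LinearCombinations.module_hom_add[OF coset_tensor_hom] free_gen_pair)
  finally show ?thesis by (simp add: pure_tensor_def)
qed

lemma pure_tensor_smult_left:
  assumes "c \<in> carrier K" "v \<in> carrier V" "w \<in> carrier W"
  shows "(c \<odot>\<^bsub>V\<^esub> v) \<otimes>\<^sub>T w = c \<odot>\<^bsub>T\<^esub> (v \<otimes>\<^sub>T w)"
proof -
  have "N +>\<^bsub>F\<^esub> free_gen K (c \<odot>\<^bsub>V\<^esub> v, w) = N +>\<^bsub>F\<^esub> (c \<odot>\<^bsub>F\<^esub> free_gen K (v, w))"
  proof (rule relator_coset_eq)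
  qed (use assms in \<open>unfold tensor_relators_def Let_def, blast\<close>, simp_all add: assms free_gen_pair)
  also have "\<dots> = c \<odot>\<^bsub>T\<^esub> (v \<otimes>\<^sub>T w)"
    unfolding pure_tensor_def using assms
    by (intro LinearCombinations.module_hom_smult[OF coset_tensor_hom] free_gen_pair)
  finally show ?thesis by (simp add: pure_tensor_def)
qed

lemma pure_tensor_smult_right:
  assumes "c \<in> carrier K" "v \<in> carrier V" "w \<in> carrier W"
  shows "v \<otimes>\<^sub>T (c \<odot>\<^bsub>W\<^esub> w) = c \<odot>\<^bsub>T\<^esub> (v \<otimes>\<^sub>T w)"
proof -
  have "N +>\<^bsub>F\<^esub> free_gen K (v, c \<odot>\<^bsub>W\<^esub> w) = N +>\<^bsub>F\<^esub> (c \<odot>\<^bsub>F\<^esub> free_gen K (v, w))"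
  proof (rule relator_coset_eq)
  qed (use assms in \<open>unfold tensor_relators_def Let_def, blast\<close>, simp_all add: assms free_gen_pair)
  also have "\<dots> = c \<odot>\<^bsub>T\<^esub> (v \<otimes>\<^sub>T w)"
    unfolding pure_tensor_def using assms
    by (intro LinearCombinations.module_hom_smult[OF coset_tensor_hom] free_gen_pair)
  finally show ?thesis by (simp add: pure_tensor_def)
qed

text \<open>Precomposing with the projection from the free module reduces the claim to the free generators,
  whose images are the pure tensors.\<close>

lemma tensor_hom_eqI:
  assumes "Module.module K P" and f: "f \<in> module_hom K T P" and g: "g \<in> module_hom K T P"
    and pure: "\<And>v w. \<lbrakk>v \<in> carrier V; w \<in> carrier W\<rbrakk> \<Longrightarrow> f (v \<otimes>\<^sub>T w) = g (v \<otimes>\<^sub>T w)"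
    and t: "t \<in> carrier T"
  shows "f t = g t"
proof -
  obtain x where x: "x \<in> carrier F" "t = N +>\<^bsub>F\<^esub> x"
    using t F.coset_onto[of N] unfolding tensor_vs_def by blast
  have "f (N +>\<^bsub>F\<^esub> x) = g (N +>\<^bsub>F\<^esub> x)"
    by (rule V.R.free_vs_hom_eqI[OF assms(1) module_hom_comp[OF coset_tensor_hom f]
          module_hom_comp[OF coset_tensor_hom g] _ x(1)])
      (use pure in \<open>auto simp: pure_tensor_def\<close>)
  with x show ?thesis by simp
qed

text \<open>The universal property of the tensor product: the linear extension of a bilinear map to the free
  module kills each of the four kinds of relators, hence their span.\<close>

lemma tensor_lift:
  fixes P :: "('k, 'p, 'q) module_scheme"
  assumes P: "Module.module K P"
    and left: "\<And>w. w \<in> carrier W \<Longrightarrow> (\<lambda>v. \<beta> v w) \<in> module_hom K V P"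
    and right: "\<And>v. v \<in> carrier V \<Longrightarrow> \<beta> v \<in> module_hom K W P"
  obtains \<mu> where "\<mu> \<in> module_hom K T P"
    and "\<And>v w. \<lbrakk>v \<in> carrier V; w \<in> carrier W\<rbrakk> \<Longrightarrow> \<mu> (v \<otimes>\<^sub>T w) = \<beta> v w"
proof -
  interpret P: Module.module K P by (rule P)
  define L where "L = free_lift K P (\<lambda>(v, w). \<beta> v w)"
  have \<beta>: "\<beta> v w \<in> carrier P" if "v \<in> carrier V" "w \<in> carrier W" for v w
    using LinearCombinations.module_hom_closed[OF right[OF that(1)]] that(2) by auto
  have L: "L \<in> module_hom K F P"
    unfolding L_def by (rule P.free_lift_hom) (auto simp: \<beta>)
  interpret L: mod_hom K F P L by unfold_locales (rule L)
  have gen: "L (free_gen K (v, w)) = \<beta> v w" if "v \<in> carrier V" "w \<in> carrier W" for v w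
    unfolding L_def using \<beta>[OF that] by (subst P.free_lift_gen) auto
  have "tensor_relators K V W \<subseteq> L.ker"
  proof
    fix x assume x: "x \<in> tensor_relators K V W"
    then have "L x = \<zero>\<^bsub>P\<^esub>"
      using LinearCombinations.module_hom_add[OF left] LinearCombinations.module_hom_add[OF right] LinearCombinations.module_hom_smult[OF left] LinearCombinations.module_hom_smult[OF right]
      by (auto simp: tensor_relators_def Let_def gen free_gen_pair \<beta> P.r_neg a_minus_def[of P])
    with x show "x \<in> L.ker" using tensor_relators_closed by (auto simp: L.ker_def)
  qed
  then have "N \<subseteq> L.ker"
    unfolding tensor_null_def by (rule F.span_is_subset[OF _ L.ker_is_submodule])
  then obtain \<mu> where \<mu>: "\<mu> \<in> module_hom K T P" "\<And>x. x \<in> carrier F \<Longrightarrow> \<mu> (N +>\<^bsub>F\<^esub> x) = L x"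
    using F.quotient_vs_lift[OF tensor_null_submodule P L] unfolding tensor_vs_def L.ker_def by blast
  show ?thesis
  proof (rule that[OF \<mu>(1)])
    fix v w assume "v \<in> carrier V" "w \<in> carrier W"
    then show "\<mu> (v \<otimes>\<^sub>T w) = \<beta> v w"
      unfolding pure_tensor_def by (simp add: \<mu>(2) free_gen_pair gen)
  qed
qed

text \<open>The hypotheses describe an inverse of \<open>\<mu>\<close>: the elements \<open>e i\<close> generate \<open>V\<close> with coordinates \<open>l i\<close>,
  the map \<open>\<phi> i\<close> extracts the coefficient of \<open>e i\<close>, and the inverse sends \<open>x\<close> to
  \<open>\<Sum>\<^sub>i e\<^sub>i \<otimes> \<phi>\<^sub>i x\<close>. That this is a left inverse need only be checked on pure tensors, where the
  scalar \<open>l i v\<close> moves across the tensor sign and the sum collapses to \<open>v\<close>.\<close>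

lemma tensor_map_bij:
  fixes P :: "('k, 'p, 'q) module_scheme"
  assumes P: "Module.module K P" and \<mu>: "\<mu> \<in> module_hom K T P"
    and I: "finite I" and e: "\<And>i. i \<in> I \<Longrightarrow> e i \<in> carrier V"
    and \<phi>: "\<And>i. i \<in> I \<Longrightarrow> \<phi> i \<in> module_hom K P W"
    and coord: "\<And>i v. \<lbrakk>i \<in> I; v \<in> carrier V\<rbrakk> \<Longrightarrow> l i v \<in> carrier K"
    and expand: "\<And>v. v \<in> carrier V \<Longrightarrow> (\<Oplus>\<^bsub>V\<^esub>i\<in>I. l i v \<odot>\<^bsub>V\<^esub> e i) = v"
    and \<phi>_pure: "\<And>i v w. \<lbrakk>i \<in> I; v \<in> carrier V; w \<in> carrier W\<rbrakk> \<Longrightarrow> \<phi> i (\<mu> (v \<otimes>\<^sub>T w)) = l i v \<odot>\<^bsub>W\<^esub> w"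
    and recon: "\<And>x. x \<in> carrier P \<Longrightarrow> (\<Oplus>\<^bsub>P\<^esub>i\<in>I. \<mu> (e i \<otimes>\<^sub>T \<phi> i x)) = x"
  shows "bij_betw \<mu> (carrier T) (carrier P)"
proof -
  interpret P: Module.module K P by (rule P)
  interpret \<mu>: mod_hom K T P \<mu> by unfold_locales (rule \<mu>)
  define \<nu> where "\<nu> x = (\<Oplus>\<^bsub>T\<^esub>i\<in>I. e i \<otimes>\<^sub>T \<phi> i x)" for x
  have \<phi>_closed: "\<phi> i x \<in> carrier W" if "i \<in> I" "x \<in> carrier P" for i x
    using LinearCombinations.module_hom_closed[OF \<phi>[OF that(1)]] that(2) by auto
  have term_closed: "e i \<otimes>\<^sub>T \<phi> i x \<in> carrier T" if "i \<in> I" "x \<in> carrier P" for i x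
    using e \<phi>_closed that by simp
  have \<nu>: "\<nu> \<in> module_hom K P T"
  proof (rule module_homI)
    fix x assume x: "x \<in> carrier P"
    then show "\<nu> x \<in> carrier T"
      unfolding \<nu>_def by (intro T.finsum_closed) (auto intro: term_closed)
    fix y assume y: "y \<in> carrier P"
    have "\<nu> (x \<oplus>\<^bsub>P\<^esub> y) = (\<Oplus>\<^bsub>T\<^esub>i\<in>I. e i \<otimes>\<^sub>T \<phi> i x \<oplus>\<^bsub>T\<^esub> e i \<otimes>\<^sub>T \<phi> i y)"
      unfolding \<nu>_def using x y
      by (intro T.finsum_cong') (auto simp: LinearCombinations.module_hom_add[OF \<phi>] e \<phi>_closed pure_tensor_add_right)
    also have "\<dots> = \<nu> x \<oplus>\<^bsub>T\<^esub> \<nu> y"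
      unfolding \<nu>_def using x y by (intro T.finsum_addf) (auto intro: term_closed)
    finally show "\<nu> (x \<oplus>\<^bsub>P\<^esub> y) = \<nu> x \<oplus>\<^bsub>T\<^esub> \<nu> y" .
  next
    fix c x assume c: "c \<in> carrier K" and x: "x \<in> carrier P"
    have "\<nu> (c \<odot>\<^bsub>P\<^esub> x) = (\<Oplus>\<^bsub>T\<^esub>i\<in>I. c \<odot>\<^bsub>T\<^esub> (e i \<otimes>\<^sub>T \<phi> i x))"
      unfolding \<nu>_def using c x
      by (intro T.finsum_cong') (auto simp: LinearCombinations.module_hom_smult[OF \<phi>] e \<phi>_closed pure_tensor_smult_right)
    also have "\<dots> = c \<odot>\<^bsub>T\<^esub> \<nu> x"
      unfolding \<nu>_def using c x I by (intro T.finsum_smult[symmetric]) (auto intro: term_closed)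
    finally show "\<nu> (c \<odot>\<^bsub>P\<^esub> x) = c \<odot>\<^bsub>T\<^esub> \<nu> x" .
  qed
  have right_inv: "\<mu> (\<nu> x) = x" if x: "x \<in> carrier P" for x
  proof -
    have "\<mu> (\<nu> x) = (\<Oplus>\<^bsub>P\<^esub>i\<in>I. \<mu> (e i \<otimes>\<^sub>T \<phi> i x))"
      unfolding \<nu>_def using I by (rule module_hom_finsum[OF T.module_axioms P \<mu>]) (auto intro: term_closed x)
    then show ?thesis using recon[OF x] by simp
  qed
  have left_inv: "\<nu> (\<mu> t) = t" if t: "t \<in> carrier T" for t
  proof (rule tensor_hom_eqI[OF T.module_axioms module_hom_comp[OF \<mu> \<nu>] _ _ t])
    show "(\<lambda>t. t) \<in> module_hom K T T" by (rule module_homI) auto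
    fix v w assume v: "v \<in> carrier V" and w: "w \<in> carrier W"
    have pure_w: "(\<lambda>v. v \<otimes>\<^sub>T w) \<in> module_hom K V T"
      using w by (intro module_homI) (auto simp: pure_tensor_add_left pure_tensor_smult_left)
    have "\<nu> (\<mu> (v \<otimes>\<^sub>T w)) = (\<Oplus>\<^bsub>T\<^esub>i\<in>I. (l i v \<odot>\<^bsub>V\<^esub> e i) \<otimes>\<^sub>T w)"
      unfolding \<nu>_def using v w coord e
      by (intro T.finsum_cong') (auto simp: \<phi>_pure pure_tensor_smult_left pure_tensor_smult_right)
    also have "\<dots> = (\<Oplus>\<^bsub>V\<^esub>i\<in>I. l i v \<odot>\<^bsub>V\<^esub> e i) \<otimes>\<^sub>T w"
      by (rule module_hom_finsum[OF V.module_axioms T.module_axioms pure_w I, symmetric])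
        (use coord e v in auto)
    also have "\<dots> = v \<otimes>\<^sub>T w" by (simp add: expand v)
    finally show "\<nu> (\<mu> (v \<otimes>\<^sub>T w)) = v \<otimes>\<^sub>T w" .
  qed
  show ?thesis
    by (rule bij_betw_byWitness[of _ \<nu>])
      (use left_inv right_inv LinearCombinations.module_hom_closed[OF \<mu>] LinearCombinations.module_hom_closed[OF \<nu>] in auto)
qed

end

section \<open>A criterion for factorizations\<close>

lemma (in assoc_algebra) unital_subalgebraI:
  assumes sub: "A \<subseteq> carrier X" and one: "\<one>\<^bsub>X\<^esub> \<in> A"
    and add: "\<And>x y. \<lbrakk>x \<in> A; y \<in> A\<rbrakk> \<Longrightarrow> x \<oplus>\<^bsub>X\<^esub> y \<in> A"
    and mult: "\<And>x y. \<lbrakk>x \<in> A; y \<in> A\<rbrakk> \<Longrightarrow> x \<otimes>\<^bsub>X\<^esub> y \<in> A"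
    and smult: "\<And>c x. \<lbrakk>c \<in> carrier K; x \<in> A\<rbrakk> \<Longrightarrow> c \<odot>\<^bsub>X\<^esub> x \<in> A"
  shows "unital_subalgebra K A X"
  unfolding unital_subalgebra_def
proof
  have "\<zero>\<^bsub>K\<^esub> \<odot>\<^bsub>X\<^esub> \<one>\<^bsub>X\<^esub> \<in> A" by (rule smult) (use one in auto)
  then have "\<zero>\<^bsub>X\<^esub> \<in> A" by simp
  then show "VectorSpace.subspace K A X"
    by (intro VectorSpace.subspace.intro LinearCombinations.submodule.intro vectorspace_axioms module_axioms
        sub add smult)
  have "\<ominus>\<^bsub>X\<^esub> x \<in> A" if "x \<in> A" for x
    using smult[of "\<ominus>\<^bsub>K\<^esub> \<one>\<^bsub>K\<^esub>" x] that sub by (simp add: smult_minus_1 subset_iff)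
  then show "subring A X"
    by (intro subringI sub one add mult)
qed

text \<open>The criterion \<open>tensor_map_bij\<close> for the multiplication map, with all sums taken in the ambient
  algebra \<open>X\<close> instead of in \<open>A\<close> or the tensor product.\<close>

lemma (in assoc_algebra) factorizesI:
  assumes A: "unital_subalgebra K A X" and B: "unital_subalgebra K B X"
    and I: "finite I" and e: "\<And>i. i \<in> I \<Longrightarrow> e i \<in> A"
    and \<phi>: "\<And>i. i \<in> I \<Longrightarrow> \<phi> i \<in> module_hom K X (X\<lparr>carrier := B\<rparr>)"
    and coord: "\<And>i a. \<lbrakk>i \<in> I; a \<in> A\<rbrakk> \<Longrightarrow> l i a \<in> carrier K"
    and expand: "\<And>a. a \<in> A \<Longrightarrow> (\<Oplus>\<^bsub>X\<^esub>i\<in>I. l i a \<odot>\<^bsub>X\<^esub> e i) = a"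
    and \<phi>_mult: "\<And>i a b. \<lbrakk>i \<in> I; a \<in> A; b \<in> B\<rbrakk> \<Longrightarrow> \<phi> i (a \<otimes>\<^bsub>X\<^esub> b) = l i a \<odot>\<^bsub>X\<^esub> b"
    and recon: "\<And>x. x \<in> carrier X \<Longrightarrow> (\<Oplus>\<^bsub>X\<^esub>i\<in>I. e i \<otimes>\<^bsub>X\<^esub> \<phi> i x) = x"
  shows "factorizes K X A B"
proof -
  let ?A = "X\<lparr>carrier := A\<rparr>" and ?B = "X\<lparr>carrier := B\<rparr>"
  have subA: "submodule K A X" and subB: "submodule K B X"
    using A B by (auto simp: unital_subalgebra_def VectorSpace.subspace_def)
  interpret tensor_factors K ?A ?B
    using submodule_is_module[OF subA] submodule_is_module[OF subB] by (rule tensor_factors.intro)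
  have AX: "a \<in> carrier X" if "a \<in> A" for a
    using that LinearCombinations.submodule.subset[OF subA] by auto
  have BX: "b \<in> carrier X" if "b \<in> B" for b
    using that LinearCombinations.submodule.subset[OF subB] by auto
  obtain \<mu> where \<mu>: "\<mu> \<in> module_hom K (tensor_vs K ?A ?B) X"
    and \<mu>_pure: "\<And>a b. \<lbrakk>a \<in> carrier ?A; b \<in> carrier ?B\<rbrakk> \<Longrightarrow> \<mu> (pure_tensor K ?A ?B a b) = a \<otimes>\<^bsub>X\<^esub> b"
  proof (rule tensor_lift[of X "\<lambda>a b. a \<otimes>\<^bsub>X\<^esub> b"])
    show "Module.module K X" by (rule module_axioms)
    fix b assume "b \<in> carrier ?B"
    then show "(\<lambda>a. a \<otimes>\<^bsub>X\<^esub> b) \<in> module_hom K ?A X"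
      by (intro module_homI) (auto simp: AX BX l_distr smult_mult_left)
  next
    fix a assume "a \<in> carrier ?A"
    then show "(\<lambda>b. a \<otimes>\<^bsub>X\<^esub> b) \<in> module_hom K ?B X"
      by (intro module_homI) (auto simp: AX BX r_distr smult_mult_right)
  qed (blast intro: that)
  have \<phi>_closed: "\<phi> i x \<in> B" if "i \<in> I" "x \<in> carrier X" for i x
    using LinearCombinations.module_hom_closed[OF \<phi>[OF that(1)]] that(2) by auto
  have "bij_betw \<mu> (carrier (tensor_vs K ?A ?B)) (carrier X)"
  proof (rule tensor_map_bij[OF module_axioms \<mu> I])
    fix a assume a: "a \<in> carrier ?A"
    \<comment> \<open>The inclusion of \<open>A\<close> is linear, so sums in \<open>A\<close> are sums in \<open>X\<close>.\<close>
    have incl: "(\<lambda>a. a) \<in> module_hom K ?A X"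
      by (rule module_homI) (auto simp: AX)
    have "(\<Oplus>\<^bsub>?A\<^esub>i\<in>I. l i a \<odot>\<^bsub>?A\<^esub> e i) = (\<Oplus>\<^bsub>X\<^esub>i\<in>I. l i a \<odot>\<^bsub>X\<^esub> e i)"
      using module_hom_finsum[OF V.module_axioms module_axioms incl I, of "\<lambda>i. l i a \<odot>\<^bsub>?A\<^esub> e i"] a coord e
        V.smult_closed by auto
    then show "(\<Oplus>\<^bsub>?A\<^esub>i\<in>I. l i a \<odot>\<^bsub>?A\<^esub> e i) = a" using a by (simp add: expand)
  next
    fix x assume x: "x \<in> carrier X"
    have "(\<Oplus>\<^bsub>X\<^esub>i\<in>I. \<mu> (pure_tensor K ?A ?B (e i) (\<phi> i x))) = (\<Oplus>\<^bsub>X\<^esub>i\<in>I. e i \<otimes>\<^bsub>X\<^esub> \<phi> i x)"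
      using x by (intro finsum_cong') (auto simp: \<mu>_pure e \<phi>_closed AX BX)
    then show "(\<Oplus>\<^bsub>X\<^esub>i\<in>I. \<mu> (pure_tensor K ?A ?B (e i) (\<phi> i x))) = x" using x by (simp add: recon)
  qed (simp_all add: e \<phi> coord \<mu>_pure \<phi>_mult)
  moreover have "linear_map K (tensor_vs K ?A ?B) X \<mu>"
    using \<mu> T.module_axioms vectorspace_axioms module_axioms field_axioms
    by (intro linear_map.intro mod_hom.intro mod_hom_axioms.intro vectorspace.intro)
  ultimately show ?thesis
    using A B \<mu>_pure assoc_algebra_axioms by (auto simp: factorizes_def linear_iso_def Let_def)
qed

section \<open>Diagonal and circulant matrices\<close>

lemma assoc_algebra_mat: "assoc_algebra class_ring (mat_algebra TYPE('a :: field) n)"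
proof -
  interpret vectorspace "class_ring :: 'a ring" "mat_algebra TYPE('a) n" by (rule matrix_vs)
  show ?thesis
    by unfold_locales
      (auto simp: module_mat_simps add_mult_distrib_mat[of _ n n _ _ n] mult_add_distrib_mat[of _ n n _ n])
qed

lemma finsum_mat_index:
  fixes f :: "'i \<Rightarrow> 'a :: field mat"
  assumes "finite I" "\<And>x. x \<in> I \<Longrightarrow> f x \<in> carrier_mat m n" "i < m" "j < n"
  shows "(\<Oplus>\<^bsub>module_mat TYPE('a) m n\<^esub>x\<in>I. f x) $$ (i, j) = (\<Sum>x\<in>I. f x $$ (i, j))"
proof -
  interpret vectorspace "class_ring :: 'a ring" "module_mat TYPE('a) m n" by (rule matrix_vs)
  have "(\<Oplus>\<^bsub>module_mat TYPE('a) m n\<^esub>x\<in>I. f x) \<in> carrier_mat m n \<and>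
      (\<Oplus>\<^bsub>module_mat TYPE('a) m n\<^esub>x\<in>I. f x) $$ (i, j) = (\<Sum>x\<in>I. f x $$ (i, j))"
    using assms(1,2)
  proof (induction I rule: finite_induct)
    case (insert x I)
    then have "(\<Oplus>\<^bsub>module_mat TYPE('a) m n\<^esub>x\<in>insert x I. f x) = f x + (\<Oplus>\<^bsub>module_mat TYPE('a) m n\<^esub>x\<in>I. f x)"
      by (subst finsum_insert) (auto simp: module_mat_simps Pi_iff)
    with insert assms(3,4) show ?case by auto
  qed (use assms(3,4) in \<open>auto simp: module_mat_simps\<close>)
  then show ?thesis ..
qed

lemma diagonal_mult_index:
  assumes "D \<in> diagonal_mats n" "A \<in> carrier_mat n n" "i < n" "j < n"
  shows "(D * A) $$ (i, j) = D $$ (i, i) * A $$ (i, j)"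
proof -
  have "(D * A) $$ (i, j) = (\<Sum>k\<in>{0..<n}. D $$ (i, k) * A $$ (k, j))"
    using assms by (auto simp: diagonal_mats_def scalar_prod_def)
  also have "\<dots> = (\<Sum>k\<in>{0..<n}. if k = i then D $$ (i, i) * A $$ (i, j) else 0)"
    using assms by (intro sum.cong) (auto simp: diagonal_mats_def diagonal_mat_def)
  finally show ?thesis using assms by simp
qed

lemma diagonal_subalgebra:
  "unital_subalgebra class_ring (diagonal_mats n) (mat_algebra TYPE('a :: field) n)"
proof -
  interpret assoc_algebra "class_ring :: 'a ring" "mat_algebra TYPE('a) n" by (rule assoc_algebra_mat)
  have carr: "D \<in> carrier_mat n n" if "D \<in> diagonal_mats n" for D :: "'a mat"
    using that by (simp add: diagonal_mats_def)
  have off: "D $$ (i, j) = 0" if "D \<in> diagonal_mats n" "i < n" "j < n" "i \<noteq> j" for D :: "'a mat" and i j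
    using that by (auto simp: diagonal_mats_def diagonal_mat_def)
  have I: "D \<in> diagonal_mats n"
    if "D \<in> carrier_mat n n" "\<And>i j. \<lbrakk>i < n; j < n; i \<noteq> j\<rbrakk> \<Longrightarrow> D $$ (i, j) = 0" for D :: "'a mat"
    using that by (auto simp: diagonal_mats_def diagonal_mat_def)
  show ?thesis
  proof (rule unital_subalgebraI; (unfold module_mat_simps)?)
    fix D E :: "'a mat" assume DE: "D \<in> diagonal_mats n" "E \<in> diagonal_mats n"
    show "D + E \<in> diagonal_mats n"
      using carr[OF DE(1)] carr[OF DE(2)] off[OF DE(1)] off[OF DE(2)] by (intro I) auto
    show "D * E \<in> diagonal_mats n"
    proof (rule I)
      fix i j assume "i < n" "j < n" "i \<noteq> j"
      then show "(D * E) $$ (i, j) = 0"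
        using diagonal_mult_index[OF DE(1) carr[OF DE(2)]] off[OF DE(2)] by simp
    qed (rule mult_carrier_mat[OF carr[OF DE(1)] carr[OF DE(2)]])
  next
    fix c and D :: "'a mat" assume D: "D \<in> diagonal_mats n"
    then show "c \<cdot>\<^sub>m D \<in> diagonal_mats n"
      using carr[OF D] off[OF D] by (intro I) auto
  qed (auto intro: I carr)
qed

lemma circ_carrier: "c \<in> carrier_vec n \<Longrightarrow> circ c \<in> carrier_mat n n"
  by (auto simp: circ_def Let_def)

lemma circ_index:
  "\<lbrakk>c \<in> carrier_vec n; i < n; j < n\<rbrakk> \<Longrightarrow> circ c $$ (i, j) = c $ ((j + n - i) mod n)"
  by (auto simp: circ_def Let_def)

lemma shift_difference:
  fixes n :: nat
  assumes "i < n"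
  shows "((j + s) mod n + n - (i + s) mod n) mod n = (j + n - i) mod n"
proof -
  have less: "(i + s) mod n < n" using assms by simp
  have "int (((j + s) mod n + n - (i + s) mod n) mod n)
      = ((int j + int s) mod int n + int n - (int i + int s) mod int n) mod int n"
    using less by (simp add: of_nat_diff zmod_int)
  also have "\<dots> = (int j + int s + int n - (int i + int s)) mod int n"
    by (metis mod_add_left_eq mod_diff_eq mod_diff_left_eq)
  also have "\<dots> = int ((j + n - i) mod n)"
    using assms by (simp add: of_nat_diff zmod_int add_diff_eq)
  finally show ?thesis by simp
qed

text \<open>If \<open>i\<close> and \<open>j\<close> have the same shift, then by \<open>shift_difference\<close> their cyclic difference
  vanishes; injectivity suffices on a finite set.\<close>

lemma shift_bij:
  fixes n :: nat
  shows "bij_betw (\<lambda>l. (l + s) mod n) {0..<n} {0..<n}"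
proof -
  have "inj_on (\<lambda>l. (l + s) mod n) {0..<n}"
  proof (rule inj_onI)
    fix i j assume ij: "i \<in> {0..<n}" "j \<in> {0..<n}" and eq: "(i + s) mod n = (j + s) mod n"
    then have "(j + n - i) mod n = 0"
      using shift_difference[of i n j s] by simp
    then have "n dvd j + n - i" by (rule mod_0_imp_dvd)
    then obtain q where q: "j + n - i = n * q" ..
    \<comment> \<open>This multiple of \<open>n\<close> lies strictly between \<open>0\<close> and \<open>2 n\<close>, so \<open>j + n - i = n\<close>.\<close>
    have "0 < n * q" "n * q < n * 2" unfolding q[symmetric] using ij by auto
    then have "q = 1" by auto
    with ij q show "i = j" by auto
  qed
  moreover from this have "(\<lambda>l. (l + s) mod n) ` {0..<n} = {0..<n}"
    by (intro endo_inj_surj) auto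
  ultimately show ?thesis by (simp add: bij_betw_def)
qed

text \<open>Invariance under simultaneous cyclic shifts of both indices is the form in which circulant matrices
  are visibly closed under products. Conversely, shifting by \<open>n - i\<close> moves row \<open>i\<close> to row \<open>0\<close>, so an
  invariant matrix is the circulant of its top row.\<close>

lemma circulant_iff_shift_invariant:
  assumes "n \<ge> 1"
  shows "A \<in> circulant_mats n \<longleftrightarrow> A \<in> carrier_mat n n \<and>
    (\<forall>i<n. \<forall>j<n. \<forall>s. A $$ ((i + s) mod n, (j + s) mod n) = A $$ (i, j))"
proof (intro iffI conjI)
  assume "A \<in> circulant_mats n"
  then obtain c where c: "c \<in> carrier_vec n" "A = circ c" by (auto simp: circulant_mats_def)
  then show "A \<in> carrier_mat n n" by (simp add: circ_carrier)
  show "\<forall>i<n. \<forall>j<n. \<forall>s. A $$ ((i + s) mod n, (j + s) mod n) = A $$ (i, j)"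
    using c assms by (simp add: circ_index shift_difference)
next
  assume A: "A \<in> carrier_mat n n \<and>
    (\<forall>i<n. \<forall>j<n. \<forall>s. A $$ ((i + s) mod n, (j + s) mod n) = A $$ (i, j))"
  have "A = circ (row A 0)"
  proof (rule eq_matI)
    fix i j assume "i < dim_row (circ (row A 0))" "j < dim_col (circ (row A 0))"
    then have ij: "i < n" "j < n" using A by (auto simp: circ_def Let_def)
    have "A $$ (i, j) = A $$ ((i + (n - i)) mod n, (j + (n - i)) mod n)"
      using A ij by metis
    also have "\<dots> = A $$ (0, (j + n - i) mod n)" using ij by simp
    finally have "A $$ (i, j) = A $$ (0, (j + n - i) mod n)" .
    moreover have "row A 0 \<in> carrier_vec n" "dim_col A = n" "dim_row A = n" using A by auto
    ultimately show "A $$ (i, j) = circ (row A 0) $$ (i, j)"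
      using ij by (simp add: circ_index)
  qed (use A in \<open>auto simp: circ_def Let_def\<close>)
  then show "A \<in> circulant_mats n"
    using A assms by (auto simp: circulant_mats_def)
qed

lemma circulant_subalgebra:
  assumes n: "n \<ge> 1"
  shows "unital_subalgebra class_ring (circulant_mats n) (mat_algebra TYPE('a :: field) n)"
proof -
  interpret assoc_algebra "class_ring :: 'a ring" "mat_algebra TYPE('a) n" by (rule assoc_algebra_mat)
  have carr: "C \<in> carrier_mat n n" if "C \<in> circulant_mats n" for C :: "'a mat"
    using that circulant_iff_shift_invariant[OF n] by blast
  have shift: "C $$ ((i + s) mod n, (j + s) mod n) = C $$ (i, j)"
    if "C \<in> circulant_mats n" "i < n" "j < n" for C :: "'a mat" and i j s
    using that circulant_iff_shift_invariant[OF n] by blast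
  have I: "C \<in> circulant_mats n"
    if "C \<in> carrier_mat n n"
      "\<And>i j s. \<lbrakk>i < n; j < n\<rbrakk> \<Longrightarrow> C $$ ((i + s) mod n, (j + s) mod n) = C $$ (i, j)" for C :: "'a mat"
    using that circulant_iff_shift_invariant[OF n] by blast
  have lt: "k mod n < n" for k using n by simp
  show ?thesis
  proof (rule unital_subalgebraI; (unfold module_mat_simps)?)
    fix C D :: "'a mat" assume CD: "C \<in> circulant_mats n" "D \<in> circulant_mats n"
    note carrs = carr[OF CD(1)] carr[OF CD(2)]
    show "C + D \<in> circulant_mats n"
      using carrs by (intro I) (simp_all add: lt shift CD)
    show "C * D \<in> circulant_mats n"
    proof (rule I)
      have index: "(C * D) $$ (i, j) = (\<Sum>l\<in>{0..<n}. C $$ (i, l) * D $$ (l, j))" if "i < n" "j < n" for i j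
        using that carrs by (auto simp: scalar_prod_def)
      fix i j s assume ij: "i < n" "j < n"
      have "(C * D) $$ ((i + s) mod n, (j + s) mod n)
          = (\<Sum>l\<in>{0..<n}. C $$ ((i + s) mod n, l) * D $$ (l, (j + s) mod n))"
        by (rule index[OF lt lt])
      \<comment> \<open>Shift the summation index as well, so that invariance applies to both factors.\<close>
      also have "\<dots> = (\<Sum>l\<in>{0..<n}. C $$ ((i + s) mod n, (l + s) mod n) * D $$ ((l + s) mod n, (j + s) mod n))"
        by (rule sum.reindex_bij_betw[OF shift_bij, symmetric])
      also have "\<dots> = (C * D) $$ (i, j)"
        using ij by (simp add: index shift CD)
      finally show "(C * D) $$ ((i + s) mod n, (j + s) mod n) = (C * D) $$ (i, j)" .
    qed (rule mult_carrier_mat[OF carrs])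
  next
    fix c and C :: "'a mat" assume C: "C \<in> circulant_mats n"
    then show "c \<cdot>\<^sub>m C \<in> circulant_mats n"
      using carr[OF C] by (intro I) (simp_all add: lt shift)
  next
    show "(1\<^sub>m n :: 'a mat) \<in> circulant_mats n"
    proof (rule I)
      fix i j s assume ij: "i < n" "j < n"
      have "(i + s) mod n = (j + s) mod n \<longleftrightarrow> i = j"
        using inj_onD[OF bij_betw_imp_inj_on[OF shift_bij[of s n]], of i j] ij by auto
      then show "1\<^sub>m n $$ ((i + s) mod n, (j + s) mod n) = (1\<^sub>m n $$ (i, j) :: 'a)"
        using ij lt by simp
    qed simp
  qed (auto intro: carr)
qed

section \<open>Decomposing a matrix by rows\<close>

definition diag_unit :: "nat \<Rightarrow> nat \<Rightarrow> 'a :: field mat" where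
  "diag_unit n i = mat n n (\<lambda>(j, k). if j = i \<and> k = i then 1 else 0)"

text \<open>The circulant matrix with the same \<open>i\<close>-th row as \<open>A\<close>: the coefficient \<open>c\<^sub>k\<close> of a circulant matrix
  stands in column \<open>i + k\<close> of row \<open>i\<close>, modulo \<open>n\<close>.\<close>

definition row_circulant :: "nat \<Rightarrow> nat \<Rightarrow> 'a mat \<Rightarrow> 'a mat" where
  "row_circulant n i A = circ (vec n (\<lambda>k. A $$ (i, (i + k) mod n)))"

lemma diag_unit_diagonal: "diag_unit n i \<in> diagonal_mats n"
  by (auto simp: diag_unit_def diagonal_mats_def diagonal_mat_def)

lemma row_circulant_carrier: "row_circulant n i A \<in> carrier_mat n n"
  by (simp add: row_circulant_def circ_carrier)

lemma row_circulant_index: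
  "\<lbrakk>j < n; k < n\<rbrakk> \<Longrightarrow> row_circulant n i A $$ (j, k) = A $$ (i, (i + (k + n - j)) mod n)"
  by (simp add: row_circulant_def circ_index mod_simps)

lemma row_circulant_row:
  assumes "i < n" "k < n"
  shows "row_circulant n i A $$ (i, k) = A $$ (i, k)"
proof -
  have "i + (k + n - i) = k + n" using assms by simp
  then show ?thesis using assms by (simp add: row_circulant_index)
qed

lemma row_circulant_hom:
  fixes n :: nat
  assumes "i < n"
  shows "row_circulant n i \<in> module_hom class_ring (mat_algebra TYPE('a :: field) n)
    ((mat_algebra TYPE('a) n)\<lparr>carrier := circulant_mats n\<rparr>)"
proof (rule module_homI)
  fix A :: "'a mat"
  show "row_circulant n i A \<in> carrier ((mat_algebra TYPE('a) n)\<lparr>carrier := circulant_mats n\<rparr>)"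
    by (simp add: row_circulant_def circulant_mats_def)
next
  fix A B :: "'a mat" assume "A \<in> carrier (mat_algebra TYPE('a) n)" "B \<in> carrier (mat_algebra TYPE('a) n)"
  then show "row_circulant n i (A \<oplus>\<^bsub>mat_algebra TYPE('a) n\<^esub> B)
      = row_circulant n i A \<oplus>\<^bsub>(mat_algebra TYPE('a) n)\<lparr>carrier := circulant_mats n\<rparr>\<^esub> row_circulant n i B"
    using assms row_circulant_carrier[of n i A] row_circulant_carrier[of n i B] row_circulant_carrier[of n i "A + B"]
    by (auto simp: module_mat_simps row_circulant_index intro!: eq_matI)
next
  fix c :: 'a and A :: "'a mat" assume "A \<in> carrier (mat_algebra TYPE('a) n)"
  then show "row_circulant n i (c \<odot>\<^bsub>mat_algebra TYPE('a) n\<^esub> A)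
      = c \<odot>\<^bsub>(mat_algebra TYPE('a) n)\<lparr>carrier := circulant_mats n\<rparr>\<^esub> row_circulant n i A"
    using assms row_circulant_carrier[of n i A] row_circulant_carrier[of n i "c \<cdot>\<^sub>m A"]
    by (auto simp: module_mat_simps row_circulant_index intro!: eq_matI)
qed

text \<open>Both sides are circulant and agree in row \<open>i\<close>, where \<open>D C\<close> is \<open>D\<^sub>i\<^sub>i\<close> times the row of \<open>C\<close>.\<close>

lemma row_circulant_diagonal_mult:
  assumes D: "D \<in> diagonal_mats n" and C: "C \<in> circulant_mats n" and i: "i < n"
  shows "row_circulant n i (D * C) = D $$ (i, i) \<cdot>\<^sub>m C"
proof (rule eq_matI)
  have n: "n \<ge> 1" using i by simp
  have carr: "C \<in> carrier_mat n n" using C circulant_iff_shift_invariant[OF n] by blast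
  show "dim_row (row_circulant n i (D * C)) = dim_row (D $$ (i, i) \<cdot>\<^sub>m C)"
    "dim_col (row_circulant n i (D * C)) = dim_col (D $$ (i, i) \<cdot>\<^sub>m C)"
    using carr row_circulant_carrier[of n i "D * C"] by auto
  fix j k assume "j < dim_row (D $$ (i, i) \<cdot>\<^sub>m C)" "k < dim_col (D $$ (i, i) \<cdot>\<^sub>m C)"
  then have jk: "j < n" "k < n" using carr by auto
  \<comment> \<open>The cyclic shift that takes row \<open>j\<close> to row \<open>i\<close>.\<close>
  define s where "s = i + n - j"
  have s: "(j + s) mod n = i" "(k + s) mod n = (i + (k + n - j)) mod n"
    using jk i by (simp_all add: s_def algebra_simps)
  have "C $$ ((j + s) mod n, (k + s) mod n) = C $$ (j, k)"
    using C jk circulant_iff_shift_invariant[OF n] by blast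
  then have "C $$ (i, (i + (k + n - j)) mod n) = C $$ (j, k)" by (simp only: s)
  then show "row_circulant n i (D * C) $$ (j, k) = (D $$ (i, i) \<cdot>\<^sub>m C) $$ (j, k)"
    using jk i carr by (simp add: row_circulant_index diagonal_mult_index[OF D carr])
qed

lemma diagonal_expansion:
  fixes D :: "'a :: field mat"
  assumes "D \<in> diagonal_mats n"
  shows "(\<Oplus>\<^bsub>mat_algebra TYPE('a) n\<^esub>i\<in>{0..<n}. D $$ (i, i) \<cdot>\<^sub>m diag_unit n i) = D"
proof -
  interpret assoc_algebra "class_ring :: 'a ring" "mat_algebra TYPE('a) n" by (rule assoc_algebra_mat)
  have t: "D $$ (i, i) \<cdot>\<^sub>m diag_unit n i \<in> carrier_mat n n" for i by (simp add: diag_unit_def)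
  have S: "(\<Oplus>\<^bsub>mat_algebra TYPE('a) n\<^esub>i\<in>{0..<n}. D $$ (i, i) \<cdot>\<^sub>m diag_unit n i) \<in> carrier_mat n n"
    using finsum_closed[of "\<lambda>i. D $$ (i, i) \<cdot>\<^sub>m diag_unit n i" "{0..<n}"] t by (simp add: module_mat_simps Pi_iff)
  show ?thesis
  proof (rule eq_matI)
    fix j k assume "j < dim_row D" "k < dim_col D"
    then have jk: "j < n" "k < n" using assms by (auto simp: diagonal_mats_def)
    have "(\<Oplus>\<^bsub>mat_algebra TYPE('a) n\<^esub>i\<in>{0..<n}. D $$ (i, i) \<cdot>\<^sub>m diag_unit n i) $$ (j, k)
        = (\<Sum>i\<in>{0..<n}. (D $$ (i, i) \<cdot>\<^sub>m diag_unit n i) $$ (j, k))"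
      using t jk by (intro finsum_mat_index) auto
    also have "\<dots> = (\<Sum>i\<in>{0..<n}. if i = j then D $$ (j, k) else 0)"
      using jk assms by (intro sum.cong) (auto simp: diag_unit_def diagonal_mats_def diagonal_mat_def)
    also have "\<dots> = D $$ (j, k)" using jk by simp
    finally show "(\<Oplus>\<^bsub>mat_algebra TYPE('a) n\<^esub>i\<in>{0..<n}. D $$ (i, i) \<cdot>\<^sub>m diag_unit n i) $$ (j, k) = D $$ (j, k)" .
  qed (use S assms in \<open>auto simp: diagonal_mats_def\<close>)
qed

text \<open>Left multiplication by the \<open>i\<close>-th diagonal idempotent keeps row \<open>i\<close> and erases the others, so the
  sum assembles \<open>A\<close> from its rows.\<close>

lemma row_circulant_expansion:
  fixes A :: "'a :: field mat"
  assumes A: "A \<in> carrier_mat n n"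
  shows "(\<Oplus>\<^bsub>mat_algebra TYPE('a) n\<^esub>i\<in>{0..<n}. diag_unit n i * row_circulant n i A) = A"
proof -
  interpret assoc_algebra "class_ring :: 'a ring" "mat_algebra TYPE('a) n" by (rule assoc_algebra_mat)
  have t: "diag_unit n i * row_circulant n i A \<in> carrier_mat n n" for i
    using row_circulant_carrier by (intro mult_carrier_mat) (auto simp: diag_unit_def)
  have S: "(\<Oplus>\<^bsub>mat_algebra TYPE('a) n\<^esub>i\<in>{0..<n}. diag_unit n i * row_circulant n i A) \<in> carrier_mat n n"
    using finsum_closed[of "\<lambda>i. diag_unit n i * row_circulant n i A" "{0..<n}"] t
    by (simp add: module_mat_simps Pi_iff)
  show ?thesis
  proof (rule eq_matI)
    fix j k assume "j < dim_row A" "k < dim_col A"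
    then have jk: "j < n" "k < n" using A by auto
    have "(\<Oplus>\<^bsub>mat_algebra TYPE('a) n\<^esub>i\<in>{0..<n}. diag_unit n i * row_circulant n i A) $$ (j, k)
        = (\<Sum>i\<in>{0..<n}. (diag_unit n i * row_circulant n i A) $$ (j, k))"
      using t jk by (intro finsum_mat_index) auto
    also have "\<dots> = (\<Sum>i\<in>{0..<n}. if i = j then A $$ (j, k) else 0)"
    proof (rule sum.cong)
      fix i assume "i \<in> {0..<n}"
      have "(diag_unit n i * row_circulant n i A) $$ (j, k)
          = diag_unit n i $$ (j, j) * row_circulant n i A $$ (j, k)"
        by (rule diagonal_mult_index[OF diag_unit_diagonal row_circulant_carrier jk])
      then show "(diag_unit n i * row_circulant n i A) $$ (j, k) = (if i = j then A $$ (j, k) else 0)"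
        using jk by (auto simp: diag_unit_def row_circulant_row)
    qed simp
    also have "\<dots> = A $$ (j, k)" using jk by simp
    finally show "(\<Oplus>\<^bsub>mat_algebra TYPE('a) n\<^esub>i\<in>{0..<n}. diag_unit n i * row_circulant n i A) $$ (j, k) = A $$ (j, k)" .
  qed (use S A in auto)
qed

theorem proposition3p2:
  fixes n :: nat
  assumes "n \<ge> 1"
  shows "factorizes class_ring (mat_algebra TYPE('a :: field_char_0) n)
           (diagonal_mats n) (circulant_mats n)"
proof -
  interpret assoc_algebra "class_ring :: 'a ring" "mat_algebra TYPE('a) n" by (rule assoc_algebra_mat)
  show ?thesis
  proof (rule factorizesI[of _ _ "{0..<n}" "diag_unit n" "row_circulant n" "\<lambda>i D. D $$ (i, i)"])
  qed (simp_all add: diagonal_subalgebra circulant_subalgebra[OF assms] diag_unit_diagonal row_circulant_hom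
      module_mat_simps diagonal_expansion row_circulant_expansion row_circulant_diagonal_mult)
qed

end
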